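(* Let $\mathcal{S}$ be a nonempty set and let $X$ and $Y$ be lenses with source $\mathcal{S}$ and views $V_1$ and $V_2$ respectively. Then the scenes $X^\sim$ and $Y^\sim$ are independent if and only if $\mathrm{put}_X\,v_1\circ \mathrm{put}_Y\,v_2=\mathrm{put}_Y\,v_2\circ \mathrm{put}_X\,v_1$ for all $v_1\in V_1$, $v_2\in V_2$.
   Context: A lens $X$ with view $V$ and source $\mathcal{S}$ consists of functions $\mathrm{get}_X:\mathcal{S}\to V$ and $\mathrm{put}_X:V\to\mathcal{S}\to\mathcal{S}$ satisfying, for all $s\in\mathcal{S}$ and $v,v'\in V$: $\mathrm{get}_X(\mathrm{put}_X\,v\,s)=v$, $\mathrm{put}_X\,v\,(\mathrm{put}_X\,v'\,s)=\mathrm{put}_X\,v\,s$, and $\mathrm{put}_X\,(\mathrm{get}_X\,s)\,s=s$. A scene on $\mathcal{S}$ is a function $F:\mathcal{S}\to\mathcal{S}\to\mathcal{S}$ satisfying, for all $x,y,z$: $F\,(F\,x\,y)\,z=F\,x\,z$, $F\,x\,(F\,y\,z)=F\,x\,z$, $F\,x\,x=x$. Scenes $F,G$ on $\mathcal{S}$ are independent if $G\,(F\,s_1\,s_2)\,s_3=F\,(G\,s_1\,s_3)\,s_2$ for all $s_1,s_2,s_3\in\mathcal{S}$. The scene of a lens $X$ is $X^\sim=(\lambda s_1\,s_2.\ \mathrm{put}_X\,(\mathrm{get}_X\,s_2)\,s_1)$. *)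

theory Defs
  imports Main
begin

text \<open>The source and the views are types. Every HOL type is inhabited, so the source is a
  nonempty set.\<close>

record ('v, 's) lens =
  lens_get :: "'s \<Rightarrow> 'v"
  lens_put :: "'v \<Rightarrow> 's \<Rightarrow> 's"

definition is_lens :: "('v, 's) lens \<Rightarrow> bool" where
  "is_lens X \<longleftrightarrow>
     (\<forall>v s. lens_get X (lens_put X v s) = v) \<and>
     (\<forall>v v' s. lens_put X v (lens_put X v' s) = lens_put X v s) \<and>
     (\<forall>s. lens_put X (lens_get X s) s = s)"

definition is_scene :: "('s \<Rightarrow> 's \<Rightarrow> 's) \<Rightarrow> bool" where
  "is_scene F \<longleftrightarrow>
     (\<forall>x y z. F (F x y) z = F x z) \<and>
     (\<forall>x y z. F x (F y z) = F x z) \<and>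
     (\<forall>x. F x x = x)"

text \<open>Independence is a relation between scenes, so both arguments are required to be scenes.\<close>

definition scene_indep :: "('s \<Rightarrow> 's \<Rightarrow> 's) \<Rightarrow> ('s \<Rightarrow> 's \<Rightarrow> 's) \<Rightarrow> bool" where
  "scene_indep F G \<longleftrightarrow>
     is_scene F \<and> is_scene G \<and>
     (\<forall>s1 s2 s3. G (F s1 s2) s3 = F (G s1 s3) s2)"

definition lens_scene :: "('v, 's) lens \<Rightarrow> 's \<Rightarrow> 's \<Rightarrow> 's" where
  "lens_scene X = (\<lambda>s1 s2. lens_put X (lens_get X s2) s1)"

lemma is_scene_lens_scene: "is_lens X \<Longrightarrow> is_scene (lens_scene X)"
  by (simp add: is_lens_def is_scene_def lens_scene_def)

end

theory Submission
  imports Defs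
begin

text \<open>Unfolded, independence says that \<open>lens_put X (lens_get X s2)\<close> and
  \<open>lens_put Y (lens_get Y s3)\<close> commute for all states \<open>s2\<close>,
  \<open>s3\<close>. Since getting after putting returns the view put, every view has the form
  \<open>lens_get X s2\<close> (or \<open>lens_get Y s3\<close>), so this is commutation for all
  views.\<close>

theorem theorem11:
  fixes X :: "('v1, 's) lens" and Y :: "('v2, 's) lens"
  assumes "is_lens X" and "is_lens Y"
  shows "scene_indep (lens_scene X) (lens_scene Y) \<longleftrightarrow>
    (\<forall>v1 v2. lens_put X v1 \<circ> lens_put Y v2 = lens_put Y v2 \<circ> lens_put X v1)"
proof
  assume indep: "scene_indep (lens_scene X) (lens_scene Y)"
  show "\<forall>v1 v2. lens_put X v1 \<circ> lens_put Y v2 = lens_put Y v2 \<circ> lens_put X v1"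
  proof (intro allI ext)
    fix v1 v2 s
    \<comment> \<open>The get functions are surjective, so these states realise arbitrary views.\<close>
    let ?s2 = "lens_put X v1 s" and ?s3 = "lens_put Y v2 s"
    have "lens_scene Y (lens_scene X s ?s2) ?s3 = lens_scene X (lens_scene Y s ?s3) ?s2"
      using indep by (simp add: scene_indep_def)
    then show "(lens_put X v1 \<circ> lens_put Y v2) s = (lens_put Y v2 \<circ> lens_put X v1) s"
      using assms by (simp add: lens_scene_def is_lens_def)
  qed
next
  assume "\<forall>v1 v2. lens_put X v1 \<circ> lens_put Y v2 = lens_put Y v2 \<circ> lens_put X v1"
  then have "lens_put X v1 (lens_put Y v2 s) = lens_put Y v2 (lens_put X v1 s)" for v1 v2 s
    by (metis comp_apply)
  \<comment> \<open>The independence equation is commutation at \<open>v1 = lens_get X s2\<close>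
    and \<open>v2 = lens_get Y s3\<close>; the lens laws supply the scene conjuncts.\<close>
  then show "scene_indep (lens_scene X) (lens_scene Y)"
    using assms[THEN is_scene_lens_scene] by (simp add: scene_indep_def lens_scene_def)
qed

end
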